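(* For every primitive-recursive step function $f$ and every $n\in\mathbb N$, $\emptyset\vdash(\mathrm{rrep}(f)\cdot\underline n)\,\mathsf B$ is derivable in OGA.
   Context: **Syntax.** Terms: $t::=v_i\mid\bot\mid\mathbf 0\mid\mathbf S t\mid t=t\mid\neg t\mid t\lor t\mid\lambda t\mid t\cdot t\mid\mathcal R\mid\mathcal A$ ($v_i$, $i\in\mathbb N$, de Bruijn variables; $\lambda$ is the only binder; application associates to the left). A term is well-formed (wf) if generated by this grammar. $\bot$ is a divergent constant, $\mathcal R$ the primitive recursor, $\mathcal A$ the universal quantifier. Abbreviations: $t\,\mathsf N$ is $t=t$; $t\,\mathsf B$ is $t\lor\neg t$; $t\ne u$ is $\neg(t=u)$; $t\land u$ is $\neg(\neg t\lor\neg u)$; $t\to u$ is $\neg t\lor u$; $\underline n=\mathbf S^n\mathbf 0$. $\uparrow$ shifts all free indices up by one; $b[t]$ is the $\beta$-instance substituting $t$ for the outermost bound variable of $b$; $[v\mapsto s]$ is capture-avoiding substitution for a free variable; $\mathrm{fv}$ is the set of free variables. **Head steps** $\triangleright$: $(\lambda b)\cdot t\triangleright b[t]$; $\mathcal R\cdot g\cdot h\cdot\mathbf 0\triangleright g$; $\mathcal R\cdot g\cdot h\cdot(\mathbf S\underline n)\triangleright h\cdot\underline n\cdot(\mathcal R\cdot g\cdot h\cdot\underline n)$; if $t\triangleright t'$ then $t\cdot u\triangleright t'\cdot u$. **Rules.** Judgments are $\Gamma\vdash c$, $\Gamma$ a finite set of wf terms, $c$ a wf term (all terms in rules are wf). A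 proof is a finite list of judgments each following from earlier entries by one rule; $\Gamma\vdash c$ is derivable if it occurs in a proof. Rules ("$\Rightarrow$" from premises to conclusion, "$\Leftrightarrow$" both directions; $\Gamma$ is the context of a judgment when none is shown): $\Gamma,c\vdash c$; $\Gamma\vdash c\Rightarrow\Gamma,a\vdash c$; $\Gamma\vdash a$ and $\Gamma,a\vdash c\Rightarrow\Gamma\vdash c$; $\Gamma\vdash c\Rightarrow[v\mapsto s]\Gamma\vdash[v\mapsto s]c$; $\vdash a\Leftrightarrow\ \vdash a=\underline1$; $\vdash\neg a\Leftrightarrow\ \vdash a=\underline0$; $\vdash\neg a,\ \vdash a\Rightarrow\ \vdash c$; $\vdash a\Leftrightarrow\ \vdash\neg\neg a$; $\vdash a\Rightarrow\ \vdash a\lor b$; $\vdash b\Rightarrow\ \vdash a\lor b$; $\vdash\neg a,\ \vdash\neg b\Rightarrow\ \vdash\neg(a\lor b)$; $\vdash a\lor b,\ \Gamma,a\vdash c,\ \Gamma,b\vdash c\Rightarrow\ \vdash c$; $\vdash\neg(a\lor b)\Rightarrow\ \vdash\neg a$; $\vdash\neg(a\lor b)\Rightarrow\ \vdash\neg b$; $\vdash a\,\mathsf N\Leftrightarrow\ \vdash a=a$; $\vdash a=b\Rightarrow\ \vdash b=a$; $\vdash a=b,\ \vdash[v\mapsto a]p\Rightarrow\ \vdash[v\mapsto b]p$; $\vdash a\ne b\Rightarrow\ \vdash b\ne a$; $\vdash a\,\mathsf N,\ \vdash b\,\mathsf N\Rightarrow\ \vdash(a=b)\,\mathsf B$; $\vdash(a=b)\,\mathsf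 B\Rightarrow\ \vdash(a\,\mathsf N)\land(b\,\mathsf N)$; $\vdash\mathbf 0\,\mathsf N$; $\vdash a\,\mathsf N\Leftrightarrow\ \vdash(\mathbf S a)\,\mathsf N$; $\vdash a\,\mathsf N\Rightarrow\ \vdash\mathbf S a\ne\mathbf 0$; $\vdash a\ne b\Leftrightarrow\ \vdash\mathbf S a\ne\mathbf S b$; $\vdash\mathbf S a=\mathbf S b\Rightarrow\ \vdash a=b$; $\vdash\bot\,\mathsf N\Rightarrow\ \vdash p$; induction: $\vdash[v_i\mapsto\mathbf 0]c$, $\ v_i\,\mathsf N,c,\Gamma\vdash[v_i\mapsto\mathbf S v_i]c$, $\ \vdash a\,\mathsf N\Rightarrow\ \vdash[v_i\mapsto a]c$ if $v_i\notin\mathrm{fv}(\Gamma)$; conversion, for $c\triangleright c'$: $\vdash c'\Rightarrow\ \vdash c$; $\vdash c\Rightarrow\ \vdash c'$; $\vdash\neg c\Rightarrow\ \vdash\neg c'$; $\vdash c'\,\mathsf N\Rightarrow\ \vdash c=c'$; $\vdash m\,\mathsf N,\ \vdash(h\cdot m\cdot(\mathcal R\cdot g\cdot h\cdot m))\,\mathsf N\Rightarrow\ \vdash\mathcal R\cdot g\cdot h\cdot(\mathbf S m)=h\cdot m\cdot(\mathcal R\cdot g\cdot h\cdot m)$; $v_0\,\mathsf N,\uparrow\Gamma\vdash\uparrow f\cdot v_0\Rightarrow\Gamma\vdash\mathcal A\cdot f$; $\vdash\mathcal A\cdot f,\ \vdash a\,\mathsf N\Rightarrow\ \vdash f\cdot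 a$; $\vdash\neg(f\cdot a),\ \vdash a\,\mathsf N\Rightarrow\ \vdash\neg(\mathcal A\cdot f)$; $\Gamma\vdash\neg(\mathcal A\cdot f)$ and $v_0\,\mathsf N,\neg(\uparrow f\cdot v_0),\uparrow\Gamma\vdash\uparrow c\Rightarrow\Gamma\vdash c$. These are the rules of RGA. OGA has these and the rule ATI: $\Gamma\vdash\mathcal A\cdot(\lambda((\uparrow u\cdot v_0)\,\mathsf B))\Rightarrow\Gamma\vdash(\mathcal A\cdot u)\,\mathsf B$. **Search sentences.** A step function is a primitive recursive $f:\mathbb N^2\to\mathbb N$ presented by a primitive recursive definition (from zero, successor, projections by composition and primitive recursion). Its search at $n$ hits at step $k$ if $f(n,k)\neq0$, and hits if it hits at some step. $\mathrm{cmp}(f)$ is the closed term obtained by compiling the definition into curried $\lambda$-terms: zero functions to $\lambda\cdots\lambda\,\mathbf 0$, successor to $\lambda\,\mathbf S v_0$, projections to $\lambda\cdots\lambda\,v_i$, composition to the corresponding applications, and $F(0,\vec x)=G(\vec x)$, $F(m+1,\vec x)=H(m,F(m,\vec x),\vec x)$ to the curried term sending $y,\vec x$ to $\mathcal R\cdot(\mathrm{cmp}(G)\cdot\vec x)\cdot(\lambda\lambda\,\mathrm{cmp}(H)\cdot v_1\cdot v_0\cdot\vec x)\cdot y$ (indices of $\vec x$ shifted under the $\lambda$s). Put $\mathrm{rmat}(f,n)=\lambda(\mathrm{cmp}(f)\cdot\underline n\cdot v_0=\mathbf 0)$ and $\mathrm{rrep}(f)=\lambda\,\neg(\mathcal A\cdot\lambda(\mathrm{cmp}(f)\cdot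 v_1\cdot v_0=\mathbf 0))$. So $\mathrm{rrep}(f)\cdot\underline n\triangleright\neg(\mathcal A\cdot\mathrm{rmat}(f,n))$ expresses that the search of $f$ at $n$ hits. *)

theory Defs
  imports Main "HOL-Library.FSet"
begin

section \<open>Terms\<close>

datatype tm =
    Var nat
  | Bot
  | Zero
  | Succ tm
  | Eq tm tm  (infix "\<^bold>=" 60)
  | Neg tm  ("\<^bold>\<not> _" [70] 70)
  | Or tm tm  (infixr "\<^bold>\<or>" 55)
  | Lam tm
  | App tm tm  (infixl "\<cdot>" 90)
  | Rec
  | Forall

abbreviation isN :: "tm \<Rightarrow> tm"  ("_ \<^bold>N" [80] 80)
  where "t \<^bold>N \<equiv> t \<^bold>= t"

abbreviation isB :: "tm \<Rightarrow> tm"  ("_ \<^bold>B" [80] 80)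
  where "t \<^bold>B \<equiv> t \<^bold>\<or> \<^bold>\<not> t"

abbreviation Neq :: "tm \<Rightarrow> tm \<Rightarrow> tm"  (infix "\<^bold>\<noteq>" 60)
  where "t \<^bold>\<noteq> u \<equiv> \<^bold>\<not> (t \<^bold>= u)"

abbreviation Conj :: "tm \<Rightarrow> tm \<Rightarrow> tm"  (infixr "\<^bold>\<and>" 57)
  where "t \<^bold>\<and> u \<equiv> \<^bold>\<not> (\<^bold>\<not> t \<^bold>\<or> \<^bold>\<not> u)"

definition num :: "nat \<Rightarrow> tm"
  where "num n = (Succ ^^ n) Zero"

text \<open>\<open>lift c t\<close> increments the free indices of \<open>t\<close> that are at least \<open>c\<close>.\<close>

primrec lift :: "nat \<Rightarrow> tm \<Rightarrow> tm" where
  "lift c (Var i) = Var (if i < c then i else Suc i)"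
| "lift c Bot = Bot"
| "lift c Zero = Zero"
| "lift c (Succ t) = Succ (lift c t)"
| "lift c (t \<^bold>= u) = (lift c t \<^bold>= lift c u)"
| "lift c (\<^bold>\<not> t) = \<^bold>\<not> (lift c t)"
| "lift c (t \<^bold>\<or> u) = (lift c t \<^bold>\<or> lift c u)"
| "lift c (Lam t) = Lam (lift (Suc c) t)"
| "lift c (t \<cdot> u) = lift c t \<cdot> lift c u"
| "lift c Rec = Rec"
| "lift c Forall = Forall"

abbreviation shift :: "tm \<Rightarrow> tm"  ("\<up>")
  where "\<up> \<equiv> lift 0"

text \<open>
  \<open>inst k s b\<close> removes the index \<open>k\<close> from \<open>b\<close>: \<open>s\<close> is put in its place and the free indices
  above it are decremented. So \<open>inst 0 t b\<close> is the beta-instance of the body \<open>b\<close> at \<open>t\<close>.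
\<close>

primrec inst :: "nat \<Rightarrow> tm \<Rightarrow> tm \<Rightarrow> tm" where
  "inst k s (Var i) = (if i < k then Var i else if i = k then s else Var (i - 1))"
| "inst k s Bot = Bot"
| "inst k s Zero = Zero"
| "inst k s (Succ t) = Succ (inst k s t)"
| "inst k s (t \<^bold>= u) = (inst k s t \<^bold>= inst k s u)"
| "inst k s (\<^bold>\<not> t) = \<^bold>\<not> (inst k s t)"
| "inst k s (t \<^bold>\<or> u) = (inst k s t \<^bold>\<or> inst k s u)"
| "inst k s (Lam t) = Lam (inst (Suc k) (\<up> s) t)"
| "inst k s (t \<cdot> u) = inst k s t \<cdot> inst k s u"
| "inst k s Rec = Rec"
| "inst k s Forall = Forall"

text \<open>
  \<open>subst i s t\<close> replaces the free variable \<open>Var i\<close> by \<open>s\<close>; unlike in \<open>inst\<close>, all other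
  variables keep their indices.
\<close>

primrec subst :: "nat \<Rightarrow> tm \<Rightarrow> tm \<Rightarrow> tm" where
  "subst i s (Var j) = (if j = i then s else Var j)"
| "subst i s Bot = Bot"
| "subst i s Zero = Zero"
| "subst i s (Succ t) = Succ (subst i s t)"
| "subst i s (t \<^bold>= u) = (subst i s t \<^bold>= subst i s u)"
| "subst i s (\<^bold>\<not> t) = \<^bold>\<not> (subst i s t)"
| "subst i s (t \<^bold>\<or> u) = (subst i s t \<^bold>\<or> subst i s u)"
| "subst i s (Lam t) = Lam (subst (Suc i) (\<up> s) t)"
| "subst i s (t \<cdot> u) = subst i s t \<cdot> subst i s u"
| "subst i s Rec = Rec"
| "subst i s Forall = Forall"

primrec fv :: "tm \<Rightarrow> nat set" where
  "fv (Var i) = {i}"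
| "fv Bot = {}"
| "fv Zero = {}"
| "fv (Succ t) = fv t"
| "fv (t \<^bold>= u) = fv t \<union> fv u"
| "fv (\<^bold>\<not> t) = fv t"
| "fv (t \<^bold>\<or> u) = fv t \<union> fv u"
| "fv (Lam t) = {i. Suc i \<in> fv t}"
| "fv (t \<cdot> u) = fv t \<union> fv u"
| "fv Rec = {}"
| "fv Forall = {}"

inductive head_step :: "tm \<Rightarrow> tm \<Rightarrow> bool"  (infix "\<triangleright>" 50) where
  beta: "Lam b \<cdot> t \<triangleright> inst 0 t b"
| rec_zero: "Rec \<cdot> g \<cdot> h \<cdot> Zero \<triangleright> g"
| rec_succ: "Rec \<cdot> g \<cdot> h \<cdot> Succ (num n) \<triangleright> h \<cdot> num n \<cdot> (Rec \<cdot> g \<cdot> h \<cdot> num n)"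
| app: "t \<triangleright> t' \<Longrightarrow> t \<cdot> u \<triangleright> t' \<cdot> u"


section \<open>Sequents, rules and proofs\<close>

datatype sequent = Sequent "tm fset" tm  (infix "\<turnstile>" 20)

text \<open>
  \<open>rga_rule ps j\<close> says that the sequent \<open>j\<close> follows from the list of premises \<open>ps\<close> by one
  application of a rule of RGA. The two rules between \<open>a \<^bold>N\<close> and \<open>a \<^bold>= a\<close> have no entry, as these
  are the same term.
\<close>

inductive rga_rule :: "sequent list \<Rightarrow> sequent \<Rightarrow> bool" where
  hyp: "rga_rule [] (finsert c \<Gamma> \<turnstile> c)"
| weaken: "rga_rule [\<Gamma> \<turnstile> c] (finsert a \<Gamma> \<turnstile> c)"
| cut: "rga_rule [\<Gamma> \<turnstile> a, finsert a \<Gamma> \<turnstile> c] (\<Gamma> \<turnstile> c)"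
| substitution: "rga_rule [\<Gamma> \<turnstile> c] (subst i s |`| \<Gamma> \<turnstile> subst i s c)"

| eq_one_I: "rga_rule [\<Gamma> \<turnstile> a] (\<Gamma> \<turnstile> a \<^bold>= num 1)"
| eq_one_E: "rga_rule [\<Gamma> \<turnstile> a \<^bold>= num 1] (\<Gamma> \<turnstile> a)"
| eq_zero_I: "rga_rule [\<Gamma> \<turnstile> \<^bold>\<not> a] (\<Gamma> \<turnstile> a \<^bold>= num 0)"
| eq_zero_E: "rga_rule [\<Gamma> \<turnstile> a \<^bold>= num 0] (\<Gamma> \<turnstile> \<^bold>\<not> a)"

| neg_E: "rga_rule [\<Gamma> \<turnstile> \<^bold>\<not> a, \<Gamma> \<turnstile> a] (\<Gamma> \<turnstile> c)"
| neg_neg_I: "rga_rule [\<Gamma> \<turnstile> a] (\<Gamma> \<turnstile> \<^bold>\<not> \<^bold>\<not> a)"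
| neg_neg_E: "rga_rule [\<Gamma> \<turnstile> \<^bold>\<not> \<^bold>\<not> a] (\<Gamma> \<turnstile> a)"

| or_I1: "rga_rule [\<Gamma> \<turnstile> a] (\<Gamma> \<turnstile> a \<^bold>\<or> b)"
| or_I2: "rga_rule [\<Gamma> \<turnstile> b] (\<Gamma> \<turnstile> a \<^bold>\<or> b)"
| neg_or_I: "rga_rule [\<Gamma> \<turnstile> \<^bold>\<not> a, \<Gamma> \<turnstile> \<^bold>\<not> b] (\<Gamma> \<turnstile> \<^bold>\<not> (a \<^bold>\<or> b))"
| or_E: "rga_rule [\<Gamma> \<turnstile> a \<^bold>\<or> b, finsert a \<Gamma> \<turnstile> c, finsert b \<Gamma> \<turnstile> c] (\<Gamma> \<turnstile> c)"
| neg_or_E1: "rga_rule [\<Gamma> \<turnstile> \<^bold>\<not> (a \<^bold>\<or> b)] (\<Gamma> \<turnstile> \<^bold>\<not> a)"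
| neg_or_E2: "rga_rule [\<Gamma> \<turnstile> \<^bold>\<not> (a \<^bold>\<or> b)] (\<Gamma> \<turnstile> \<^bold>\<not> b)"

| eq_sym: "rga_rule [\<Gamma> \<turnstile> a \<^bold>= b] (\<Gamma> \<turnstile> b \<^bold>= a)"
| eq_subst: "rga_rule [\<Gamma> \<turnstile> a \<^bold>= b, \<Gamma> \<turnstile> subst i a p] (\<Gamma> \<turnstile> subst i b p)"
| neq_sym: "rga_rule [\<Gamma> \<turnstile> a \<^bold>\<noteq> b] (\<Gamma> \<turnstile> b \<^bold>\<noteq> a)"
| eq_bool_I: "rga_rule [\<Gamma> \<turnstile> a \<^bold>N, \<Gamma> \<turnstile> b \<^bold>N] (\<Gamma> \<turnstile> (a \<^bold>= b) \<^bold>B)"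
| eq_bool_E: "rga_rule [\<Gamma> \<turnstile> (a \<^bold>= b) \<^bold>B] (\<Gamma> \<turnstile> a \<^bold>N \<^bold>\<and> b \<^bold>N)"

| zero_N: "rga_rule [] (\<Gamma> \<turnstile> Zero \<^bold>N)"
| succ_N_I: "rga_rule [\<Gamma> \<turnstile> a \<^bold>N] (\<Gamma> \<turnstile> (Succ a) \<^bold>N)"
| succ_N_E: "rga_rule [\<Gamma> \<turnstile> (Succ a) \<^bold>N] (\<Gamma> \<turnstile> a \<^bold>N)"
| succ_neq_zero: "rga_rule [\<Gamma> \<turnstile> a \<^bold>N] (\<Gamma> \<turnstile> Succ a \<^bold>\<noteq> Zero)"
| succ_neq_I: "rga_rule [\<Gamma> \<turnstile> a \<^bold>\<noteq> b] (\<Gamma> \<turnstile> Succ a \<^bold>\<noteq> Succ b)"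
| succ_neq_E: "rga_rule [\<Gamma> \<turnstile> Succ a \<^bold>\<noteq> Succ b] (\<Gamma> \<turnstile> a \<^bold>\<noteq> b)"
| succ_inj: "rga_rule [\<Gamma> \<turnstile> Succ a \<^bold>= Succ b] (\<Gamma> \<turnstile> a \<^bold>= b)"
| bot_E: "rga_rule [\<Gamma> \<turnstile> Bot \<^bold>N] (\<Gamma> \<turnstile> p)"

| induction:
    "(\<forall>t. t |\<in>| \<Gamma> \<longrightarrow> i \<notin> fv t) \<Longrightarrow>
     rga_rule
       [\<Gamma> \<turnstile> subst i Zero c,
        finsert ((Var i) \<^bold>N) (finsert c \<Gamma>) \<turnstile> subst i (Succ (Var i)) c,
        \<Gamma> \<turnstile> a \<^bold>N]
       (\<Gamma> \<turnstile> subst i a c)"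

| conv_expand: "c \<triangleright> c' \<Longrightarrow> rga_rule [\<Gamma> \<turnstile> c'] (\<Gamma> \<turnstile> c)"
| conv_reduce: "c \<triangleright> c' \<Longrightarrow> rga_rule [\<Gamma> \<turnstile> c] (\<Gamma> \<turnstile> c')"
| conv_neg: "c \<triangleright> c' \<Longrightarrow> rga_rule [\<Gamma> \<turnstile> \<^bold>\<not> c] (\<Gamma> \<turnstile> \<^bold>\<not> c')"
| conv_eq: "c \<triangleright> c' \<Longrightarrow> rga_rule [\<Gamma> \<turnstile> c' \<^bold>N] (\<Gamma> \<turnstile> c \<^bold>= c')"

| rec_eq:
    "rga_rule [\<Gamma> \<turnstile> m \<^bold>N, \<Gamma> \<turnstile> (h \<cdot> m \<cdot> (Rec \<cdot> g \<cdot> h \<cdot> m)) \<^bold>N]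
       (\<Gamma> \<turnstile> Rec \<cdot> g \<cdot> h \<cdot> Succ m \<^bold>= h \<cdot> m \<cdot> (Rec \<cdot> g \<cdot> h \<cdot> m))"

| forall_I:
    "rga_rule [finsert ((Var 0) \<^bold>N) (\<up> |`| \<Gamma>) \<turnstile> \<up> f \<cdot> Var 0] (\<Gamma> \<turnstile> Forall \<cdot> f)"
| forall_E: "rga_rule [\<Gamma> \<turnstile> Forall \<cdot> f, \<Gamma> \<turnstile> a \<^bold>N] (\<Gamma> \<turnstile> f \<cdot> a)"
| neg_forall_I: "rga_rule [\<Gamma> \<turnstile> \<^bold>\<not> (f \<cdot> a), \<Gamma> \<turnstile> a \<^bold>N] (\<Gamma> \<turnstile> \<^bold>\<not> (Forall \<cdot> f))"
| neg_forall_E: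
    "rga_rule
       [\<Gamma> \<turnstile> \<^bold>\<not> (Forall \<cdot> f),
        finsert ((Var 0) \<^bold>N) (finsert (\<^bold>\<not> (\<up> f \<cdot> Var 0)) (\<up> |`| \<Gamma>)) \<turnstile> \<up> c]
       (\<Gamma> \<turnstile> c)"

inductive oga_rule :: "sequent list \<Rightarrow> sequent \<Rightarrow> bool" where
  rga: "rga_rule ps j \<Longrightarrow> oga_rule ps j"
| ati: "oga_rule [\<Gamma> \<turnstile> Forall \<cdot> Lam ((\<up> u \<cdot> Var 0) \<^bold>B)] (\<Gamma> \<turnstile> (Forall \<cdot> u) \<^bold>B)"

definition is_proof :: "(sequent list \<Rightarrow> sequent \<Rightarrow> bool) \<Rightarrow> sequent list \<Rightarrow> bool" where
  "is_proof R js \<longleftrightarrow>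
     (\<forall>k < length js. \<exists>ps. set ps \<subseteq> set (take k js) \<and> R ps (js ! k))"

definition derivable :: "(sequent list \<Rightarrow> sequent \<Rightarrow> bool) \<Rightarrow> sequent \<Rightarrow> bool" where
  "derivable R j \<longleftrightarrow> (\<exists>js. is_proof R js \<and> j \<in> set js)"


section \<open>Primitive recursive definitions and search sentences\<close>

text \<open>
  The first argument of \<open>PZero\<close>, \<open>PProj\<close> and \<open>PComp\<close> is the arity of the function defined;
  \<open>PRec k g h\<close> has arity \<open>k + 1\<close>, with \<open>k\<close> the number of parameters. \<open>PProj k i\<close> selects the
  argument at position \<open>i\<close>, counted from 0.
\<close>

datatype pr =
    PZero nat
  | PSucc
  | PProj nat nat
  | PComp nat pr "pr list"
  | PRec nat pr pr

inductive pr_arity :: "pr \<Rightarrow> nat \<Rightarrow> bool" where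
  "pr_arity (PZero k) k"
| "pr_arity PSucc 1"
| "i < k \<Longrightarrow> pr_arity (PProj k i) k"
| "pr_arity h (length gs) \<Longrightarrow> (\<And>g. g \<in> set gs \<Longrightarrow> pr_arity g k) \<Longrightarrow> pr_arity (PComp k h gs) k"
| "pr_arity g k \<Longrightarrow> pr_arity h (k + 2) \<Longrightarrow> pr_arity (PRec k g h) (k + 1)"

fun pr_eval :: "pr \<Rightarrow> nat list \<Rightarrow> nat" where
  "pr_eval (PZero k) xs = 0"
| "pr_eval PSucc xs = Suc (hd xs)"
| "pr_eval (PProj k i) xs = xs ! i"
| "pr_eval (PComp k h gs) xs = pr_eval h (map (\<lambda>g. pr_eval g xs) gs)"
| "pr_eval (PRec k g h) xs =
     rec_nat (pr_eval g (tl xs)) (\<lambda>m r. pr_eval h (m # r # tl xs)) (hd xs)"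

text \<open>
  A step function \<open>f\<close> comes with a primitive recursive definition \<open>d\<close>, on which the terms
  below depend.
\<close>

definition step_function :: "pr \<Rightarrow> (nat \<Rightarrow> nat \<Rightarrow> nat) \<Rightarrow> bool" where
  "step_function d f \<longleftrightarrow> pr_arity d 2 \<and> (\<forall>n k. pr_eval d [n, k] = f n k)"

abbreviation lams :: "nat \<Rightarrow> tm \<Rightarrow> tm"
  where "lams k \<equiv> Lam ^^ k"

abbreviation apps :: "tm \<Rightarrow> tm list \<Rightarrow> tm"
  where "apps \<equiv> foldl App"

text \<open>
  The first of \<open>k\<close> arguments is bound by the outermost abstraction, so under \<open>lams k\<close> the
  arguments are \<open>Var (k - 1), \<dots>, Var 0\<close> in this order. \<open>args k c\<close> is this list as seen under
  \<open>c\<close> further abstractions.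
\<close>

definition args :: "nat \<Rightarrow> nat \<Rightarrow> tm list"
  where "args k c = map Var (rev [c..<c + k])"

text \<open>
  Compiled terms are closed, so they need no shifting where they occur under abstractions. In the
  last equation, the recursion argument is \<open>Var k\<close> and the parameters are \<open>args k 0\<close>.
\<close>

fun cmp :: "pr \<Rightarrow> tm" where
  "cmp (PZero k) = lams k Zero"
| "cmp PSucc = Lam (Succ (Var 0))"
| "cmp (PProj k i) = lams k (Var (k - 1 - i))"
| "cmp (PComp k h gs) = lams k (apps (cmp h) (map (\<lambda>g. apps (cmp g) (args k 0)) gs))"
| "cmp (PRec k g h) =
     lams (k + 1)
       (Rec \<cdot> apps (cmp g) (args k 0)
            \<cdot> Lam (Lam (apps (cmp h \<cdot> Var 1 \<cdot> Var 0) (args k 2)))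
            \<cdot> Var k)"

definition rrep :: "pr \<Rightarrow> tm" where
  "rrep d = Lam (\<^bold>\<not> (Forall \<cdot> Lam (cmp d \<cdot> Var 1 \<cdot> Var 0 \<^bold>= Zero)))"

end

theory Submission
  imports Defs
begin

text \<open>
  Compiled primitive recursive terms are provably total: \<open>\<Gamma> \<turnstile> (cmp d \<cdot> t\<^sub>1 \<cdots> t\<^sub>k) \<^bold>N\<close> whenever all
  \<open>\<Gamma> \<turnstile> t\<^sub>i \<^bold>N\<close>, by induction on \<open>d\<close>; the recursor case uses the induction rule of the calculus at a
  fresh variable. Hence the matrix of the search sentence is a boolean at every number variable,
  and ATI makes its universal closure a boolean.
\<close>

section \<open>Derivability\<close>

lemma is_proof_append:
  assumes "is_proof R js" "is_proof R ks"
  shows "is_proof R (js @ ks)"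
  unfolding is_proof_def
proof (intro allI impI)
  fix k assume k: "k < length (js @ ks)"
  show "\<exists>ps. set ps \<subseteq> set (take k (js @ ks)) \<and> R ps ((js @ ks) ! k)"
  proof (cases "k < length js")
    case True
    then show ?thesis using assms(1) by (simp add: is_proof_def nth_append)
  next
    case False
    then have "k - length js < length ks" using k by simp
    then obtain ps where "set ps \<subseteq> set (take (k - length js) ks)" "R ps (ks ! (k - length js))"
      using assms(2) unfolding is_proof_def by blast
    then show ?thesis using False by (intro exI[of _ ps]) (auto simp: nth_append)
  qed
qed

lemma common_proof:
  assumes "\<forall>p\<in>set ps. derivable R p"
  shows "\<exists>js. is_proof R js \<and> set ps \<subseteq> set js"
  using assms
proof (induction ps)
  case Nil
  show ?case by (intro exI[of _ "[]"]) (simp add: is_proof_def)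
next
  case (Cons p ps)
  then obtain js ks where "is_proof R js" "set ps \<subseteq> set js" "is_proof R ks" "p \<in> set ks"
    by (auto simp: derivable_def)
  then show ?case by (intro exI[of _ "js @ ks"]) (auto intro: is_proof_append)
qed

text \<open>Concatenating proofs of the premises and appending \<open>j\<close> gives a proof of
  \<open>j\<close>. From here on derivability is handled through this closure property
  alone.\<close>

lemma derivable_rule:
  assumes "R ps j" "\<forall>p\<in>set ps. derivable R p"
  shows "derivable R j"
proof -
  obtain js where js: "is_proof R js" "set ps \<subseteq> set js"
    using common_proof[OF assms(2)] by blast
  have "is_proof R (js @ [j])"
    unfolding is_proof_def
  proof (intro allI impI)
    fix k assume "k < length (js @ [j])"
    then consider "k < length js" | "k = length js" by fastforce
    then show "\<exists>ps. set ps \<subseteq> set (take k (js @ [j])) \<and> R ps ((js @ [j]) ! k)"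
    proof cases
      case 1
      then show ?thesis using js(1) by (simp add: is_proof_def nth_append)
    next
      case 2
      then show ?thesis using js(2) assms(1) by auto
    qed
  qed
  then show ?thesis unfolding derivable_def by (intro exI[of _ "js @ [j]"]) simp
qed

section \<open>Derived rules of OGA for numbers and booleans\<close>

abbreviation head_steps :: "tm \<Rightarrow> tm \<Rightarrow> bool"  (infix "\<triangleright>\<^sup>*" 50)
  where "c \<triangleright>\<^sup>* c' \<equiv> head_step\<^sup>*\<^sup>* c c'"

abbreviation oga :: "tm fset \<Rightarrow> tm \<Rightarrow> bool"  (infix "\<turnstile>\<^sub>O" 20)
  where "\<Gamma> \<turnstile>\<^sub>O c \<equiv> derivable oga_rule (\<Gamma> \<turnstile> c)"

lemma oga_rga_rule:
  assumes "rga_rule ps j" "\<forall>p\<in>set ps. derivable oga_rule p"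
  shows "derivable oga_rule j"
  using derivable_rule[of oga_rule, OF oga_rule.rga[OF assms(1)] assms(2)] .

lemma oga_hyp: "c |\<in>| \<Gamma> \<Longrightarrow> \<Gamma> \<turnstile>\<^sub>O c"
  using oga_rga_rule[OF rga_rule.hyp[of c \<Gamma>]] by (simp add: finsert_absorb)

lemma oga_weaken: "\<Gamma> \<turnstile>\<^sub>O c \<Longrightarrow> finsert a \<Gamma> \<turnstile>\<^sub>O c"
  by (rule oga_rga_rule[OF rga_rule.weaken]) simp

lemma oga_or_E: "\<Gamma> \<turnstile>\<^sub>O a \<^bold>\<or> b \<Longrightarrow> finsert a \<Gamma> \<turnstile>\<^sub>O c \<Longrightarrow> finsert b \<Gamma> \<turnstile>\<^sub>O c \<Longrightarrow> \<Gamma> \<turnstile>\<^sub>O c"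
  by (rule oga_rga_rule[OF rga_rule.or_E[of _ a b]]) simp

lemma oga_eq_sym: "\<Gamma> \<turnstile>\<^sub>O a \<^bold>= b \<Longrightarrow> \<Gamma> \<turnstile>\<^sub>O b \<^bold>= a"
  by (rule oga_rga_rule[OF rga_rule.eq_sym]) simp

lemma oga_eq_subst: "\<Gamma> \<turnstile>\<^sub>O a \<^bold>= b \<Longrightarrow> \<Gamma> \<turnstile>\<^sub>O subst i a p \<Longrightarrow> \<Gamma> \<turnstile>\<^sub>O subst i b p"
  by (rule oga_rga_rule[OF rga_rule.eq_subst[of _ a]]) simp

lemma oga_zero_N: "\<Gamma> \<turnstile>\<^sub>O Zero \<^bold>N"
  by (rule oga_rga_rule[OF rga_rule.zero_N]) simp

lemma oga_succ_N: "\<Gamma> \<turnstile>\<^sub>O a \<^bold>N \<Longrightarrow> \<Gamma> \<turnstile>\<^sub>O (Succ a) \<^bold>N"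
  by (rule oga_rga_rule[OF rga_rule.succ_N_I]) simp

lemma oga_num_N: "\<Gamma> \<turnstile>\<^sub>O (num n) \<^bold>N"
  by (induction n) (auto simp: num_def intro: oga_zero_N oga_succ_N)

lemma oga_conv_expand: "c \<triangleright> c' \<Longrightarrow> \<Gamma> \<turnstile>\<^sub>O c' \<Longrightarrow> \<Gamma> \<turnstile>\<^sub>O c"
  by (rule oga_rga_rule[OF rga_rule.conv_expand]) simp_all

lemma oga_conv_eq: "c \<triangleright> c' \<Longrightarrow> \<Gamma> \<turnstile>\<^sub>O c' \<^bold>N \<Longrightarrow> \<Gamma> \<turnstile>\<^sub>O c \<^bold>= c'"
  by (rule oga_rga_rule[OF rga_rule.conv_eq]) simp_all

text \<open>The pattern equating \<open>Var 0\<close> with itself lets the reversed equation rewrite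
  both sides of the reflexive equation for \<open>b\<close> at once.\<close>

lemma oga_eq_N:
  assumes "\<Gamma> \<turnstile>\<^sub>O a \<^bold>= b" "\<Gamma> \<turnstile>\<^sub>O b \<^bold>N"
  shows "\<Gamma> \<turnstile>\<^sub>O a \<^bold>N"
  using oga_eq_subst[OF oga_eq_sym[OF assms(1)], of 0 "Var 0 \<^bold>= Var 0"] assms(2) by simp

text \<open>Each head step yields an equation through \<open>conv_eq\<close>, which requires the
  reduct to be a number; hence the induction runs backwards from \<open>c'\<close>.\<close>

lemma oga_conv_N: "c \<triangleright>\<^sup>* c' \<Longrightarrow> \<Gamma> \<turnstile>\<^sub>O c' \<^bold>N \<Longrightarrow> \<Gamma> \<turnstile>\<^sub>O c \<^bold>N"
  by (induction rule: converse_rtranclp_induct) (auto intro: oga_eq_N oga_conv_eq)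

text \<open>Asserting \<open>a\<close> makes it equal to the numeral 1, refuting it makes it equal
  to 0; numerals are numbers.\<close>

lemma oga_bool_N:
  assumes "\<Gamma> \<turnstile>\<^sub>O a \<^bold>B"
  shows "\<Gamma> \<turnstile>\<^sub>O a \<^bold>N"
proof (rule oga_or_E[OF assms])
  have "finsert a \<Gamma> \<turnstile>\<^sub>O a \<^bold>= num 1"
    by (rule oga_rga_rule[OF rga_rule.eq_one_I]) (simp add: oga_hyp)
  then show "finsert a \<Gamma> \<turnstile>\<^sub>O a \<^bold>N" by (rule oga_eq_N) (rule oga_num_N)
  have "finsert (\<^bold>\<not> a) \<Gamma> \<turnstile>\<^sub>O a \<^bold>= num 0"
    by (rule oga_rga_rule[OF rga_rule.eq_zero_I]) (simp add: oga_hyp)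
  then show "finsert (\<^bold>\<not> a) \<Gamma> \<turnstile>\<^sub>O a \<^bold>N" by (rule oga_eq_N) (rule oga_num_N)
qed

text \<open>
  Conversion does not lead from \<open>\<^bold>\<not> c'\<close> back to \<open>\<^bold>\<not> c\<close>; the equation \<open>c \<^bold>= c'\<close>, available because
  booleans are numbers, does.
\<close>

lemma oga_conv_bool:
  assumes "c \<triangleright> c'" "\<Gamma> \<turnstile>\<^sub>O c' \<^bold>B"
  shows "\<Gamma> \<turnstile>\<^sub>O c \<^bold>B"
  using oga_eq_subst[OF oga_eq_sym[OF oga_conv_eq[OF assms(1) oga_bool_N[OF assms(2)]]],
      of 0 "(Var 0) \<^bold>B"] assms(2)
  by simp

text \<open>Needed because ATI decides a universal sentence, while the search sentence is the
  negation of one.\<close>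

lemma oga_neg_bool:
  assumes "\<Gamma> \<turnstile>\<^sub>O a \<^bold>B"
  shows "\<Gamma> \<turnstile>\<^sub>O (\<^bold>\<not> a) \<^bold>B"
proof (rule oga_or_E[OF assms])
  have "finsert a \<Gamma> \<turnstile>\<^sub>O \<^bold>\<not> \<^bold>\<not> a"
    by (rule oga_rga_rule[OF rga_rule.neg_neg_I]) (simp add: oga_hyp)
  then show "finsert a \<Gamma> \<turnstile>\<^sub>O (\<^bold>\<not> a) \<^bold>B"
    by (intro oga_rga_rule[OF rga_rule.or_I2]) simp
  show "finsert (\<^bold>\<not> a) \<Gamma> \<turnstile>\<^sub>O (\<^bold>\<not> a) \<^bold>B"
    by (rule oga_rga_rule[OF rga_rule.or_I1]) (simp add: oga_hyp)
qed


section \<open>Substitution\<close>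

lemma finite_fv: "finite (fv t)"
proof (induction t)
  case (Lam t)
  have "fv (Lam t) = Suc -` fv t" by auto
  then show ?case using Lam by (simp add: finite_vimageI)
qed auto

lemma subst_fresh: "i \<notin> fv t \<Longrightarrow> subst i s t = t"
  by (induction t arbitrary: i s) auto

text \<open>A bound on the free indices, unlike closedness, survives passing under
  \<open>Lam\<close>; the same holds for \<open>inst_closed\<close>.\<close>

lemma lift_closed: "fv t \<subseteq> {..<c} \<Longrightarrow> lift c t = t"
proof (induction t arbitrary: c)
  case (Lam t)
  have "fv t \<subseteq> {..<Suc c}"
  proof
    fix i assume "i \<in> fv t" then show "i \<in> {..<Suc c}" using Lam.prems by (cases i) auto
  qed
  then show ?case using Lam.IH by simp
qed auto

lemma inst_closed: "fv t \<subseteq> {..<k} \<Longrightarrow> inst k s t = t"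
proof (induction t arbitrary: k s)
  case (Lam t)
  have "fv t \<subseteq> {..<Suc k}"
  proof
    fix i assume "i \<in> fv t" then show "i \<in> {..<Suc k}" using Lam.prems by (cases i) auto
  qed
  then show ?case using Lam.IH by simp
qed auto

lemma inst_lift: "inst k s (lift k t) = t"
  by (induction t arbitrary: k s) auto

lemma lift_lift: "c \<le> k \<Longrightarrow> lift (Suc k) (lift c t) = lift c (lift k t)"
  by (induction t arbitrary: c k) auto

text \<open>After \<open>k\<close> shifts no free index is below \<open>k\<close>, so the cutoff
  \<open>k\<close> acts like 0. With \<open>inst_lift\<close>, instantiating an absent index then
  cancels one shift.\<close>

lemma lift_shifts: "lift k ((\<up> ^^ k) t) = (\<up> ^^ Suc k) t"
  by (induction k arbitrary: t) (simp_all add: lift_lift)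

lemma inst_shifts: "inst j s ((\<up> ^^ Suc j) t) = (\<up> ^^ j) t"
  by (simp only: lift_shifts[symmetric] inst_lift)

text \<open>
  \<open>minst c ts b\<close> instantiates the indices \<open>c + k - 1, \<dots>, c\<close> of \<open>b\<close>, with \<open>k = length ts\<close>, by
  \<open>ts\<close> in this order, as \<open>k\<close> successive beta steps under \<open>c\<close> abstractions do.
\<close>

fun minst :: "nat \<Rightarrow> tm list \<Rightarrow> tm \<Rightarrow> tm" where
  "minst c [] b = b"
| "minst c (t # ts) b =
     minst c ts (inst (c + length ts) ((\<up> ^^ (c + length ts)) t) b)"

lemma minst_simps [simp]:
  "minst c ts Zero = Zero"
  "minst c ts Rec = Rec"
  "minst c ts (Succ a) = Succ (minst c ts a)"
  "minst c ts (a \<cdot> b) = minst c ts a \<cdot> minst c ts b"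
  "minst c ts (Lam a) = Lam (minst (Suc c) ts a)"
  by (induction ts arbitrary: a b) simp_all

lemma minst_apps: "minst c ts (apps a bs) = apps (minst c ts a) (map (minst c ts) bs)"
  by (induction bs arbitrary: a) simp_all

lemma minst_closed: "fv t = {} \<Longrightarrow> minst c ts t = t"
  by (induction ts) (simp_all add: inst_closed)

text \<open>The instantiated indices do not occur in the shifted term, so each instantiation merely
  cancels one shift. Thus arguments already inserted survive the later beta steps.\<close>

lemma minst_shifts: "minst c ts ((\<up> ^^ (c + length ts)) t) = (\<up> ^^ c) t"
proof (induction ts)
  case (Cons a ts)
  show ?case
    using Cons inst_shifts[of "c + length ts"] by simp
qed simp

lemma minst_Var_less: "j < c \<Longrightarrow> minst c ts (Var j) = Var j"
  by (induction ts) simp_all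

lemma minst_Var:
  "i < length ts \<Longrightarrow> minst c ts (Var (c + length ts - Suc i)) = (\<up> ^^ c) (ts ! i)"
proof (induction ts arbitrary: i)
  case (Cons t ts)
  \<comment> \<open>For \<open>i = 0\<close> a shifted \<open>t\<close> is inserted and the
    remaining instantiations strip its shifts. Otherwise the index is too small for the first
    instantiation to affect it.\<close>
  then show ?case by (cases i) (auto simp: minst_shifts)
qed simp

lemma minst_args:
  assumes "length ts = k"
  shows "map (minst c ts) (args k c) = map (\<up> ^^ c) ts"
proof (rule nth_equalityI)
  fix i assume "i < length (map (minst c ts) (args k c))"
  then have i: "i < length ts" using assms by (simp add: args_def)
  have "rev [c..<c + k] ! i = c + length ts - Suc i"
    using i assms by (simp add: rev_nth)
  then show "map (minst c ts) (args k c) ! i = map (\<up> ^^ c) ts ! i"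
    using i assms minst_Var[OF i, of c] by (simp add: args_def)
qed (simp add: assms args_def)

lemma inst_lams: "inst c s (lams k b) = lams k (inst (c + k) ((\<up> ^^ k) s) b)"
  by (induction k arbitrary: c s) (simp_all add: funpow_swap1[of "\<up>"])

lemma head_step_apps: "t \<triangleright> t' \<Longrightarrow> apps t us \<triangleright> apps t' us"
  by (induction us arbitrary: t t') (auto intro: head_step.app)

lemma apps_lams: "length ts = k \<Longrightarrow> apps (lams k b) ts \<triangleright>\<^sup>* minst 0 ts b"
proof (induction ts arbitrary: k b)
  case (Cons t ts)
  \<comment> \<open>The first argument lands under the \<open>length ts\<close> remaining
    abstractions, hence the shifts.\<close>
  let ?b = "inst (length ts) ((\<up> ^^ length ts) t) b"
  have "apps (lams k b) (t # ts) \<triangleright> apps (lams (length ts) ?b) ts"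
    using head_step_apps[OF head_step.beta[of "lams (length ts) b" t], of ts] Cons.prems
    by (auto simp: inst_lams)
  then show ?case using Cons.IH[OF refl, of ?b] by (simp add: converse_rtranclp_into_rtranclp)
qed simp


section \<open>Totality of compiled terms\<close>

lemma fv_lams: "fv (lams k b) = {i. i + k \<in> fv b}"
  by (induction k) auto

lemma fv_apps: "fv (apps t us) = fv t \<union> \<Union> (fv ` set us)"
  by (induction us arbitrary: t) auto

lemma fv_args: "\<Union> (fv ` set (args k c)) = {c..<c + k}"
  by (auto simp: args_def)

lemma fv_cmp: "pr_arity d k \<Longrightarrow> fv (cmp d) = {}"
proof (induction rule: pr_arity.induct)
  case (4 h gs k)
  then show ?case by (auto simp: fv_lams fv_apps fv_args)
next
  case (5 g k h)
  then show ?case by (simp add: fv_lams fv_apps fv_args del: funpow.simps)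
qed (auto simp: fv_lams)

text \<open>The hypothesis on \<open>h\<close> covers all extensions of \<open>\<Gamma>\<close>
  because the induction rule adds two assumptions to the context.\<close>

lemma oga_rec_N:
  assumes "\<Gamma> \<turnstile>\<^sub>O g \<^bold>N"
    and step: "\<And>\<Delta> m r. \<Gamma> |\<subseteq>| \<Delta> \<Longrightarrow> \<Delta> \<turnstile>\<^sub>O m \<^bold>N \<Longrightarrow> \<Delta> \<turnstile>\<^sub>O r \<^bold>N \<Longrightarrow> \<Delta> \<turnstile>\<^sub>O (h \<cdot> m \<cdot> r) \<^bold>N"
    and "\<Gamma> \<turnstile>\<^sub>O a \<^bold>N"
  shows "\<Gamma> \<turnstile>\<^sub>O (Rec \<cdot> g \<cdot> h \<cdot> a) \<^bold>N"
proof -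
  \<comment> \<open>Freshness for \<open>\<Gamma>\<close> is the side condition of induction;
    freshness for \<open>g\<close> and \<open>h\<close> makes substitution in \<open>c\<close> act
    on the recursion argument only.\<close>
  have "finite (fv g \<union> fv h \<union> \<Union> (fv ` fset \<Gamma>))" by (simp add: finite_fv)
  from ex_new_if_finite[OF infinite_UNIV_nat this]
  obtain i where i: "i \<notin> fv g \<union> fv h \<union> \<Union> (fv ` fset \<Gamma>)" ..
  define c where "c = (Rec \<cdot> g \<cdot> h \<cdot> Var i) \<^bold>N"
  have subst_c: "subst i s c = (Rec \<cdot> g \<cdot> h \<cdot> s) \<^bold>N" for s
    using i by (simp add: c_def subst_fresh)
  define \<Delta> where "\<Delta> = finsert ((Var i) \<^bold>N) (finsert c \<Gamma>)"
  have "Rec \<cdot> g \<cdot> h \<cdot> Zero \<triangleright>\<^sup>* g" by (simp add: head_step.rec_zero r_into_rtranclp)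
  then have zero: "\<Gamma> \<turnstile>\<^sub>O subst i Zero c"
    unfolding subst_c using assms(1) by (rule oga_conv_N)
  have var: "\<Delta> \<turnstile>\<^sub>O (Var i) \<^bold>N" by (simp add: \<Delta>_def oga_hyp)
  have "\<Delta> \<turnstile>\<^sub>O (Rec \<cdot> g \<cdot> h \<cdot> Var i) \<^bold>N" by (simp add: \<Delta>_def c_def oga_hyp)
  then have h: "\<Delta> \<turnstile>\<^sub>O (h \<cdot> Var i \<cdot> (Rec \<cdot> g \<cdot> h \<cdot> Var i)) \<^bold>N"
    by (intro step var) (auto simp: \<Delta>_def)
  \<comment> \<open>The head step \<open>rec_succ\<close> fires only at numerals. At a variable the
    rule \<open>rec_eq\<close> replaces it, at the price of the totality facts \<open>var\<close>
    and \<open>h\<close>.\<close>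
  have "\<Delta> \<turnstile>\<^sub>O Rec \<cdot> g \<cdot> h \<cdot> Succ (Var i) \<^bold>= h \<cdot> Var i \<cdot> (Rec \<cdot> g \<cdot> h \<cdot> Var i)"
    by (rule oga_rga_rule[OF rga_rule.rec_eq]) (simp add: var h)
  then have "\<Delta> \<turnstile>\<^sub>O subst i (Succ (Var i)) c"
    unfolding subst_c using h by (rule oga_eq_N)
  then have "\<Gamma> \<turnstile>\<^sub>O subst i a c"
    using i zero assms(3)
    by (intro oga_rga_rule[OF rga_rule.induction[of \<Gamma> i c a]]) (auto simp: \<Delta>_def)
  then show ?thesis by (simp add: subst_c)
qed

lemma oga_mono:
  assumes "\<Gamma> |\<subseteq>| \<Delta>" "\<Gamma> \<turnstile>\<^sub>O c"
  shows "\<Delta> \<turnstile>\<^sub>O c"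
proof -
  have "A |\<union>| \<Gamma> \<turnstile>\<^sub>O c" for A
    by (induction A) (simp_all add: assms(2) oga_weaken)
  from this[of \<Delta>] show ?thesis using assms(1) by (simp add: sup.absorb1)
qed

text \<open>Context and arguments are generalised: composition feeds compound terms to the outer
  function, and recursion uses the hypothesis for its step function in larger contexts.\<close>

lemma oga_cmp_N:
  assumes "pr_arity d k" "length ts = k" "\<forall>t\<in>set ts. \<Gamma> \<turnstile>\<^sub>O t \<^bold>N"
  shows "\<Gamma> \<turnstile>\<^sub>O (apps (cmp d) ts) \<^bold>N"
  using assms
proof (induction arbitrary: \<Gamma> ts rule: pr_arity.induct)
  case (1 k)
  have "\<Gamma> \<turnstile>\<^sub>O (minst 0 ts Zero) \<^bold>N" by (simp add: oga_zero_N)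
  then show ?case using oga_conv_N[OF apps_lams[OF 1(1)]] by simp
next
  case 2
  then obtain t where ts: "ts = [t]" by (auto simp: length_Suc_conv)
  have "apps (lams 1 (Succ (Var 0))) ts \<triangleright>\<^sup>* minst 0 ts (Succ (Var 0))"
    by (rule apps_lams) (simp add: ts)
  from oga_conv_N[OF this, of \<Gamma>] show ?case using 2 by (simp add: ts oga_succ_N)
next
  case (3 i k)
  have "minst 0 ts (Var (k - 1 - i)) = ts ! i"
    using minst_Var[of i ts 0] 3 by simp
  then have "\<Gamma> \<turnstile>\<^sub>O (minst 0 ts (Var (k - 1 - i))) \<^bold>N" using 3 by simp
  then show ?case using oga_conv_N[OF apps_lams[OF 3(2)]] by simp
next
  case (4 h gs k)
  let ?us = "map (\<lambda>g. apps (cmp g) ts) gs"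
  have "minst 0 ts (cmp g) = cmp g" if "g \<in> set gs" for g
    using "4.hyps"(2)[OF that] by (simp add: minst_closed fv_cmp)
  then have "minst 0 ts (apps (cmp h) (map (\<lambda>g. apps (cmp g) (args k 0)) gs)) = apps (cmp h) ?us"
    using 4 minst_args[OF "4.prems"(1), of 0] "4.hyps"(1)
    by (simp add: minst_apps minst_closed fv_cmp cong: map_cong)
  moreover have "\<Gamma> \<turnstile>\<^sub>O (apps (cmp h) ?us) \<^bold>N"
    using 4 by (intro "4.IH"(1)) auto
  ultimately show ?case using oga_conv_N[OF apps_lams[OF "4.prems"(1)]] by simp
next
  case (5 g k h)
  then obtain y xs where ts: "ts = y # xs" and xs: "length xs = k"
    by (auto simp: length_Suc_conv)
  let ?hb = "\<lambda>us. apps (cmp h \<cdot> Var 1 \<cdot> Var 0) us"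
  let ?h = "Lam (Lam (?hb (map (\<up> ^^ 2) xs)))"
  let ?b = "Rec \<cdot> apps (cmp g) (args k 0) \<cdot> Lam (Lam (?hb (args k 2))) \<cdot> Var k"
  \<comment> \<open>The recursion argument \<open>y\<close> replaces index \<open>c + k\<close>,
    which lies just above all the parameter indices.\<close>
  have skip: "map (minst c ts) (args k c) = map (minst c xs) (args k c)" for c
    using xs by (auto simp: ts args_def)
  have Var_k: "minst 0 ts (Var k) = y"
    using minst_Var[of 0 ts 0] xs by (simp add: ts)
  have body: "minst 0 ts ?b = Rec \<cdot> apps (cmp g) xs \<cdot> ?h \<cdot> y"
    using minst_args[OF xs, of 0] minst_args[OF xs, of 2] "5.hyps"
    by (simp add: minst_apps minst_closed fv_cmp minst_Var_less skip Var_k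
        flip: numeral_2_eq_2)
  have "\<Gamma> \<turnstile>\<^sub>O (Rec \<cdot> apps (cmp g) xs \<cdot> ?h \<cdot> y) \<^bold>N"
  proof (rule oga_rec_N)
    show "\<Gamma> \<turnstile>\<^sub>O (apps (cmp g) xs) \<^bold>N" using 5 xs by (auto simp: ts)
    show "\<Gamma> \<turnstile>\<^sub>O y \<^bold>N" using 5 by (simp add: ts)
  next
    fix \<Delta> m r
    assume \<Delta>: "\<Gamma> |\<subseteq>| \<Delta>" and m: "\<Delta> \<turnstile>\<^sub>O m \<^bold>N" and r: "\<Delta> \<turnstile>\<^sub>O r \<^bold>N"
    \<comment> \<open>Applying \<open>?h\<close> to \<open>m\<close> and \<open>r\<close> undoes the
      two shifts that the parameters received under its abstractions.\<close>
    have shifts: "minst 0 [m, r] ((\<up> ^^ 2) t) = t" for t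
      using minst_shifts[of 0 "[m, r]" t] by (simp add: numeral_2_eq_2)
    have vars: "minst 0 [m, r] (Var 1) = m" "minst 0 [m, r] (Var 0) = r"
      using minst_Var[of 0 "[m, r]" 0] minst_Var[of 1 "[m, r]" 0] by simp_all
    have "minst 0 [m, r] (?hb (map (\<up> ^^ 2) xs)) = apps (cmp h) (m # r # xs)"
      using "5.hyps" shifts vars
      by (simp add: minst_apps minst_closed fv_cmp comp_def del: minst.simps)
    \<comment> \<open>The parameters are known to be numbers in \<open>\<Gamma>\<close>;
      monotonicity carries this to \<open>\<Delta>\<close>.\<close>
    moreover have "\<Delta> \<turnstile>\<^sub>O (apps (cmp h) (m # r # xs)) \<^bold>N"
      using 5 xs m r \<Delta> by (intro "5.IH"(2)) (auto simp: ts intro: oga_mono)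
    moreover have "?h \<cdot> m \<cdot> r \<triangleright>\<^sup>* minst 0 [m, r] (?hb (map (\<up> ^^ 2) xs))"
      using apps_lams[of "[m, r]" 2 "?hb (map (\<up> ^^ 2) xs)"]
      by (simp add: numeral_2_eq_2 del: minst.simps)
    ultimately show "\<Delta> \<turnstile>\<^sub>O (?h \<cdot> m \<cdot> r) \<^bold>N" using oga_conv_N by metis
  qed
  then show ?case
    using oga_conv_N[OF apps_lams[OF "5.prems"(1), of ?b]] body by simp
qed

section \<open>Deciding the search sentence\<close>

lemma fv_num: "fv (num n) = {}"
  by (induction n) (simp_all add: num_def)

theorem lemma4p1:
  fixes d :: pr and f :: "nat \<Rightarrow> nat \<Rightarrow> nat" and n :: nat
  assumes "step_function d f"
  shows "derivable oga_rule ({||} \<turnstile> (rrep d \<cdot> num n) \<^bold>B)"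
proof -
  have d: "pr_arity d 2" using assms by (simp add: step_function_def)
  note closed = fv_cmp[OF d] fv_num
  \<comment> \<open>This is the matrix \<open>rmat\<close> of the search sentence at
    \<open>n\<close>; being closed, it is unaffected by the shifts in \<open>forall_I\<close> and
    ATI.\<close>
  define u where "u = Lam (cmp d \<cdot> num n \<cdot> Var 0 \<^bold>= Zero)"
  have fv_u: "fv u = {}" by (auto simp: u_def closed)
  have rrep_step: "rrep d \<cdot> num n \<triangleright> \<^bold>\<not> (Forall \<cdot> u)"
    unfolding rrep_def
    using head_step.beta[of "\<^bold>\<not> (Forall \<cdot> Lam (cmp d \<cdot> Var 1 \<cdot> Var 0 \<^bold>= Zero))" "num n"]
    by (simp add: u_def closed inst_closed lift_closed)
  \<comment> \<open>The context that \<open>forall_I\<close> supplies when its conclusion has the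
    empty context.\<close>
  let ?\<Gamma> = "{|(Var 0) \<^bold>N|}"
  have "?\<Gamma> \<turnstile>\<^sub>O (apps (cmp d) [num n, Var 0]) \<^bold>N"
    by (rule oga_cmp_N[OF d]) (auto intro: oga_num_N oga_hyp)
  then have "?\<Gamma> \<turnstile>\<^sub>O (cmp d \<cdot> num n \<cdot> Var 0 \<^bold>= Zero) \<^bold>B"
    by (intro oga_rga_rule[OF rga_rule.eq_bool_I]) (simp add: oga_zero_N)
  moreover have "u \<cdot> Var 0 \<triangleright> (cmp d \<cdot> num n \<cdot> Var 0 \<^bold>= Zero)"
    using head_step.beta[of "cmp d \<cdot> num n \<cdot> Var 0 \<^bold>= Zero" "Var 0"]
    by (simp add: u_def closed inst_closed)
  ultimately have "?\<Gamma> \<turnstile>\<^sub>O (u \<cdot> Var 0) \<^bold>B" using oga_conv_bool by blast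
  moreover have "Lam ((u \<cdot> Var 0) \<^bold>B) \<cdot> Var 0 \<triangleright> (u \<cdot> Var 0) \<^bold>B"
    using head_step.beta[of "(u \<cdot> Var 0) \<^bold>B" "Var 0"] by (simp add: fv_u inst_closed)
  \<comment> \<open>Here the redex is the whole formula, so plain expansion suffices; the earlier
    one occurred inside a disjunction and under a negation.\<close>
  ultimately have "?\<Gamma> \<turnstile>\<^sub>O Lam ((u \<cdot> Var 0) \<^bold>B) \<cdot> Var 0" using oga_conv_expand by blast
  then have "{||} \<turnstile>\<^sub>O Forall \<cdot> Lam ((\<up> u \<cdot> Var 0) \<^bold>B)"
    by (intro oga_rga_rule[OF rga_rule.forall_I]) (simp add: fv_u lift_closed)
  then have "{||} \<turnstile>\<^sub>O (Forall \<cdot> u) \<^bold>B"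
    by (intro derivable_rule[of oga_rule, OF oga_rule.ati]) simp
  then show ?thesis by (rule oga_conv_bool[OF rrep_step oga_neg_bool])
qed

end
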